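(* Let $G$ be a finitely generated group with one or two ends, and let $S$ be a finite set of generators of $G$. Then the Cayley graph of $G$ with respect to the generating set $\{g\in G\mid d_S(g,1_G)\leq 3\}$ admits a bi-infinite Hamiltonian path.
   Context: $d_S$ is the left-invariant word metric on $G$: $d_S(g,h)$ is the length of the shortest word $w\in(S\cup S^{-1})^*$ such that $g$ times the element represented by $w$ equals $h$. For a finite generating set $T$, the (undirected, right) Cayley graph $\operatorname{Cay}(G,T)$ has vertex set $G$ and edges joining $g$ to $gs$ for $g\in G$, $s\in T\cup T^{-1}$. The number of ends of a graph $\Gamma$ is the supremum, over finite vertex sets $V$, of the number of infinite connected components of $\Gamma-V$; the number of ends of $G$ is the number of ends of its Cayley graph for any finite generating set. A bi-infinite Hamiltonian path on a graph is a bijection from $\mathbb{Z}$ to its vertex set that sends consecutive integers to adjacent vertices. *)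

theory Defs
  imports
    "HOL-Algebra.Generated_Groups"
    "HOL-Library.Extended_Nat"
    "Graph_Theory.Digraph_Component"
begin

definition finite_generating_set :: "('a, 'm) monoid_scheme \<Rightarrow> 'a set \<Rightarrow> bool" where
  "finite_generating_set G S \<longleftrightarrow> finite S \<and> S \<subseteq> carrier G \<and> generate G S = carrier G"

definition finitely_generated :: "('a, 'm) monoid_scheme \<Rightarrow> bool" where
  "finitely_generated G \<longleftrightarrow> (\<exists>S. finite_generating_set G S)"

definition symmetrized :: "('a, 'm) monoid_scheme \<Rightarrow> 'a set \<Rightarrow> 'a set" where
  "symmetrized G S = S \<union> m_inv G ` S"

definition word_value :: "('a, 'm) monoid_scheme \<Rightarrow> 'a list \<Rightarrow> 'a" where
  "word_value G w = foldr (\<lambda>x y. x \<otimes>\<^bsub>G\<^esub> y) w \<one>\<^bsub>G\<^esub>"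

text \<open>The word metric. It is only meaningful when \<open>S\<close> generates \<open>G\<close>: otherwise there may
  be no word at all, and \<open>LEAST\<close> is unspecified.\<close>

definition word_dist :: "('a, 'm) monoid_scheme \<Rightarrow> 'a set \<Rightarrow> 'a \<Rightarrow> 'a \<Rightarrow> nat" where
  "word_dist G S g h =
    (LEAST n. \<exists>w. set w \<subseteq> symmetrized G S \<and> length w = n \<and> g \<otimes>\<^bsub>G\<^esub> word_value G w = h)"

text \<open>Undirected graphs are represented by symmetric digraphs: every edge is present as a pair
  of opposite arcs. Loops, which arise when the unit belongs to \<open>T\<close>, are kept; they affect
  neither the connected components nor the Hamiltonian paths.\<close>

definition cayley_graph :: "('a, 'm) monoid_scheme \<Rightarrow> 'a set \<Rightarrow> ('a, 'a \<times> 'a) pre_digraph" where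
  "cayley_graph G T = with_proj
    \<lparr> pverts = carrier G,
      parcs = {(g, g \<otimes>\<^bsub>G\<^esub> s) | g s. g \<in> carrier G \<and> s \<in> symmetrized G T} \<rparr>"

definition ecard :: "'a set \<Rightarrow> enat" where
  "ecard A = (if finite A then enat (card A) else \<infinity>)"

text \<open>For a symmetric digraph, the strongly connected components are the connected components
  of the underlying undirected graph.\<close>

definition infinite_components :: "('a, 'b) pre_digraph \<Rightarrow> 'a set set" where
  "infinite_components \<Gamma> = {C \<in> pre_digraph.sccs_verts \<Gamma>. infinite C}"

definition graph_ends :: "('a, 'b) pre_digraph \<Rightarrow> enat" where
  "graph_ends \<Gamma> =
    (SUP V \<in> {V. finite V \<and> V \<subseteq> verts \<Gamma>}. ecard (infinite_components (\<Gamma> \<restriction> (verts \<Gamma> - V))))"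

text \<open>The number of ends of a finitely generated group does not depend on the finite generating
  set, so an arbitrary one is chosen.\<close>

definition group_ends :: "('a, 'm) monoid_scheme \<Rightarrow> enat" where
  "group_ends G = graph_ends (cayley_graph G (SOME T. finite_generating_set G T))"

definition bi_infinite_hamiltonian_path :: "('a, 'b) pre_digraph \<Rightarrow> (int \<Rightarrow> 'a) \<Rightarrow> bool" where
  "bi_infinite_hamiltonian_path \<Gamma> p \<longleftrightarrow>
    bij_betw p UNIV (verts \<Gamma>) \<and> (\<forall>i. p i \<rightarrow>\<^bsub>\<Gamma>\<^esub> p (i + 1))"

end

theory Submission
  imports Defs "HOL-Library.Countable_Set" "HOL-Library.Disjoint_Sets"
begin

text \<open>
  Call a sequence of disjoint finite connected sets, each with a distinguished root, a sequence of
  pieces. A finite connected graph has an enumeration that starts at the root, ends at the root or at a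
  neighbour of it, and makes jumps of length at most three (\<open>rooted_tour\<close>). Hence, if consecutive
  roots have distance at most two, the tours of the pieces can be concatenated to a one-sided infinite
  path with jumps of length at most three (\<open>ray_through_pieces\<close>).

  Every connected, locally finite graph with one end is the union of a sequence of pieces whose
  consecutive roots are adjacent (\<open>one_ended_pieces\<close>): delete the current root, keep the unique
  infinite component, put the finite remainder into the piece of the root, and move to a neighbour of the
  root in the infinite component that is closer to the first vertex not yet used.

  For a one-ended graph, the even pieces give one half of a bi-infinite path and the odd pieces the
  other half. A two-ended graph splits into two connected one-ended parts joined by an edge, and each of
  them gives one half (\<open>hamiltonian_cube_path_one_end\<close>, \<open>hamiltonian_cube_path_two_ends\<close>).

  It remains to apply this to the Cayley graph of \<open>S\<close>. The number of ends of the group is that of the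
  Cayley graph of some other finite generating set, and \<open>at_most_two_ends_transfer\<close> carries the bound
  over to \<open>S\<close>. A jump of length at most three in the Cayley graph of \<open>S\<close> is an edge of the Cayley graph of the
  ball of radius three (\<open>cayley_walk_arc\<close>).
\<close>

section \<open>Connected components of induced subgraphs\<close>

text \<open>If \<open>x \<notin> A\<close>, this is \<open>{x}\<close>. An infinite component therefore always lies inside \<open>A\<close>.\<close>

definition component :: "('a \<times> 'a) set \<Rightarrow> 'a set \<Rightarrow> 'a \<Rightarrow> 'a set" where
  "component E A x = (E \<inter> A \<times> A)\<^sup>* `` {x}"

lemma component_refl [simp]: "x \<in> component E A x"
  by (simp add: component_def)

lemma component_trans:
  "y \<in> component E A x \<Longrightarrow> z \<in> component E A y \<Longrightarrow> z \<in> component E A x"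
  by (auto simp: component_def)

lemma component_step:
  "y \<in> component E A x \<Longrightarrow> (y, z) \<in> E \<Longrightarrow> y \<in> A \<Longrightarrow> z \<in> A \<Longrightarrow> z \<in> component E A x"
  by (auto simp: component_def intro: rtrancl_into_rtrancl)

lemma component_sym:
  assumes "sym E" and "y \<in> component E A x"
  shows "x \<in> component E A y"
proof -
  have "sym ((E \<inter> A \<times> A)\<^sup>*)"
    using assms(1) by (intro sym_rtrancl) (auto simp: sym_def)
  then show ?thesis
    using assms(2) by (auto simp: component_def dest: symD)
qed

lemma component_mono: "A \<subseteq> B \<Longrightarrow> component E A x \<subseteq> component E B x"
  unfolding component_def by (intro Image_mono rtrancl_mono) auto

lemma component_closed:
  "x \<in> D \<Longrightarrow> (\<And>p q. p \<in> D \<Longrightarrow> (p, q) \<in> E \<Longrightarrow> p \<in> A \<Longrightarrow> q \<in> A \<Longrightarrow> q \<in> D) \<Longrightarrow> component E A x \<subseteq> D"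
proof
  fix y
  assume "x \<in> D" and *: "\<And>p q. p \<in> D \<Longrightarrow> (p, q) \<in> E \<Longrightarrow> p \<in> A \<Longrightarrow> q \<in> A \<Longrightarrow> q \<in> D"
    and "y \<in> component E A x"
  then have "(x, y) \<in> (E \<inter> A \<times> A)\<^sup>*"
    by (simp add: component_def)
  then show "y \<in> D"
    by (induction rule: rtrancl_induct) (use \<open>x \<in> D\<close> * in auto)
qed

lemma component_subset: "x \<in> A \<Longrightarrow> component E A x \<subseteq> A"
  by (rule component_closed)

lemma component_inside:
  "infinite (component E A x) \<Longrightarrow> x \<in> A"
proof (rule ccontr)
  assume "infinite (component E A x)" "x \<notin> A"
  moreover have "component E A x \<subseteq> {x}" if "x \<notin> A"
    by (rule component_closed) (use that in auto)
  ultimately show False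
    using finite_subset by blast
qed

text \<open>Stated for walks of a given length, because shortest walks are compared later; the version for
  components below is what is mostly used.\<close>

lemma relpow_confined:
  assumes "(x, y) \<in> (E \<inter> A \<times> A) ^^ n" and "x \<in> D"
    and "\<And>p q. p \<in> D \<Longrightarrow> (p, q) \<in> E \<Longrightarrow> p \<in> A \<Longrightarrow> q \<in> A \<Longrightarrow> q \<in> D"
  shows "y \<in> D \<and> (x, y) \<in> (E \<inter> (A \<inter> D) \<times> (A \<inter> D)) ^^ n"
  using assms(1)
proof (induction n arbitrary: y)
  case 0
  then show ?case using assms(2) by simp
next
  case (Suc n)
  then obtain z where z: "(x, z) \<in> (E \<inter> A \<times> A) ^^ n" and zy: "(z, y) \<in> E \<inter> A \<times> A"
    by auto
  with Suc.IH have "z \<in> D" "(x, z) \<in> (E \<inter> (A \<inter> D) \<times> (A \<inter> D)) ^^ n"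
    by auto
  moreover from this zy assms(3) have "y \<in> D"
    by blast
  ultimately show ?case
    using zy by (auto intro: relcompI)
qed

lemma component_confined:
  assumes "y \<in> component E A x" and "x \<in> D"
    and "\<And>p q. p \<in> D \<Longrightarrow> (p, q) \<in> E \<Longrightarrow> p \<in> A \<Longrightarrow> q \<in> A \<Longrightarrow> q \<in> D"
  shows "y \<in> component E (A \<inter> D) x"
proof -
  from assms(1) obtain n where "(x, y) \<in> (E \<inter> A \<times> A) ^^ n"
    by (auto simp: component_def rtrancl_power)
  then have "(x, y) \<in> (E \<inter> (A \<inter> D) \<times> (A \<inter> D)) ^^ n"
    using relpow_confined assms(2,3) by metis
  then show ?thesis
    by (auto simp: component_def dest: relpow_imp_rtrancl)
qed

text \<open>The part of a walk after its last visit to \<open>r\<close> is strictly shorter and avoids \<open>r\<close>. The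
  decrease in length is what makes the choice of roots in \<open>prune_root\<close> exhaust the graph.\<close>

lemma leave_root:
  assumes "(r, w) \<in> (E \<inter> U \<times> U) ^^ n" and "w \<noteq> r"
  shows "\<exists>m<n. \<exists>x. (r, x) \<in> E \<and> x \<in> U - {r} \<and>
    (x, w) \<in> (E \<inter> (U - {r}) \<times> (U - {r})) ^^ m"
  using assms
proof (induction n arbitrary: w)
  case 0
  then show ?case by simp
next
  case (Suc n)
  then obtain z where z: "(r, z) \<in> (E \<inter> U \<times> U) ^^ n" and zw: "(z, w) \<in> E" "z \<in> U" "w \<in> U"
    by auto
  show ?case
  proof (cases "z = r")
    case True
    with zw Suc.prems show ?thesis
      by (intro exI[of _ 0] exI[of _ w]) auto
  next
    case False
    with Suc.IH[OF z] obtain m x where *: "m < n" "(r, x) \<in> E" "x \<in> U - {r}"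
      "(x, z) \<in> (E \<inter> (U - {r}) \<times> (U - {r})) ^^ m"
      by blast
    from *(4) have "(x, w) \<in> (E \<inter> (U - {r}) \<times> (U - {r})) ^^ Suc m"
      by (rule relpow_Suc_I) (use zw False Suc.prems in auto)
    with * show ?thesis
      by (intro exI[of _ "Suc m"] exI[of _ x]) auto
  qed
qed

lemma component_remove_root:
  assumes "w \<in> component E U r" and "w \<noteq> r"
  obtains x where "(r, x) \<in> E" and "x \<in> U - {r}" and "w \<in> component E (U - {r}) x"
proof -
  from assms(1) obtain n where "(r, w) \<in> (E \<inter> U \<times> U) ^^ n"
    by (auto simp: component_def rtrancl_power)
  from leave_root[OF this assms(2)] that show ?thesis
    by (auto simp: component_def dest: relpow_imp_rtrancl)
qed

lemma component_subset_component:
  assumes "\<And>p q. (p, q) \<in> E \<Longrightarrow> p \<in> A \<Longrightarrow> q \<in> A \<Longrightarrow> q \<in> component E' B p"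
  shows "component E A x \<subseteq> component E' B x"
  by (rule component_closed) (auto intro: component_trans assms)

lemma component_connected_from:
  assumes "sym E" and "c \<in> A" and "x \<in> component E A c"
  shows "component E A c \<subseteq> component E (component E A c) x"
proof
  fix z assume "z \<in> component E A c"
  then have "z \<in> component E A x"
    using assms component_sym component_trans by metis
  then have "z \<in> component E (A \<inter> component E A c) x"
    using assms(3) by (rule component_confined) (rule component_step)
  then show "z \<in> component E (component E A c) x"
    using component_mono[of "A \<inter> component E A c" "component E A c"] by blast
qed

text \<open>A walk from \<open>r\<close> to a vertex outside the component of \<open>c\<close> can be taken to leave \<open>r\<close> only once, and
  then it stays in one component of \<open>U - {r}\<close>, which is not that of \<open>c\<close>. So cutting off any branch at
  \<open>r\<close> leaves a set that is still connected through \<open>r\<close>.\<close>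

lemma connected_without_component:
  assumes "sym E" and "r \<in> U" and "U \<subseteq> component E U r" and "c \<in> U - {r}"
  shows "U - component E (U - {r}) c \<subseteq> component E (U - component E (U - {r}) c) r"
proof
  define D where "D = component E (U - {r}) c"
  fix z assume z: "z \<in> U - component E (U - {r}) c"
  show "z \<in> component E (U - component E (U - {r}) c) r"
  proof (cases "z = r")
    case False
    from z assms(3) have "z \<in> component E U r"
      by blast
    then obtain x where x: "(r, x) \<in> E" "x \<in> U - {r}" "z \<in> component E (U - {r}) x"
      using False by (rule component_remove_root)
    have "x \<notin> D"
      using x z component_trans[of x E "U - {r}" c z] by (auto simp: D_def)
    have "z \<in> component E ((U - {r}) \<inter> (U - D)) x"
    proof (rule component_confined[OF x(3)])
      show "x \<in> U - D"
        using x \<open>x \<notin> D\<close> by blast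
      fix p q assume "p \<in> U - D" "(p, q) \<in> E" "p \<in> U - {r}" "q \<in> U - {r}"
      then show "q \<in> U - D"
        using component_step[of q E "U - {r}" c p] assms(1) by (auto simp: D_def dest: symD)
    qed
    then have "z \<in> component E (U - D) x"
      using component_mono[of "(U - {r}) \<inter> (U - D)" "U - D"] by blast
    moreover have "r \<in> U - D"
      using component_subset[of c "U - {r}" E] assms(2,4) by (auto simp: D_def)
    then have "x \<in> component E (U - D) r"
      by (rule component_step[OF component_refl x(1)]) (use x(2) \<open>x \<notin> D\<close> in blast)
    ultimately show ?thesis
      unfolding D_def by (rule component_trans[rotated])
  qed simp
qed

text \<open>Deleting \<open>H\<close> breaks a component into pieces that each contain \<open>x\<close> or a neighbour of \<open>H\<close>. By local
  finiteness there are finitely many pieces, so one of them is infinite.\<close>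

lemma component_minus_finite:
  assumes "sym E" and "\<And>x. finite (E `` {x})" and "finite H" and "infinite (component E A x)"
  shows "\<exists>y\<in>component E A x. infinite (component E (A - H) y)"
proof (rule ccontr)
  assume contra: "\<not> ?thesis"
  define N where "N = insert x (E `` H) \<inter> component E A x"
  have "finite (E `` H)"
    using assms(2,3) by (subst Image_eq_UN) auto
  then have "finite (\<Union>n\<in>N. component E (A - H) n)"
    using contra by (auto simp: N_def)
  moreover have "component E A x - H \<subseteq> (\<Union>n\<in>N. component E (A - H) n)"
  proof
    fix z assume "z \<in> component E A x - H"
    then have "(x, z) \<in> (E \<inter> A \<times> A)\<^sup>*" "z \<notin> H"
      by (auto simp: component_def)
    then show "z \<in> (\<Union>n\<in>N. component E (A - H) n)"
    proof (induction rule: rtrancl_induct)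
      case base
      then show ?case by (auto simp: N_def)
    next
      case (step y z)
      show ?case
      proof (cases "y \<in> H")
        case True
        have "z \<in> component E A x"
          using step(1,2) unfolding component_def by (blast intro: rtrancl_into_rtrancl)
        with True step(2) have "z \<in> N"
          by (auto simp: N_def)
        then show ?thesis
          by (intro UN_I[of z]) auto
      next
        case False
        with step show ?thesis
          by (auto intro: component_step)
      qed
    qed
  qed
  ultimately have "finite (component E A x - H)"
    by (rule rev_finite_subset)
  with assms(3,4) show False
    by simp
qed

section \<open>Bounds on the number of ends\<close>

text \<open>The number of ends is bounded by comparing vertices of infinite components instead of counting
  components; \<open>H\<close> need not be contained in \<open>C\<close>.\<close>

definition at_most_two_ends :: "('a \<times> 'a) set \<Rightarrow> 'a set \<Rightarrow> bool" where
  "at_most_two_ends E C \<longleftrightarrow> (\<forall>H x y z. finite H \<longrightarrow>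
     infinite (component E (C - H) x) \<longrightarrow> infinite (component E (C - H) y) \<longrightarrow>
     infinite (component E (C - H) z) \<longrightarrow>
     y \<in> component E (C - H) x \<or> z \<in> component E (C - H) x \<or> z \<in> component E (C - H) y)"

text \<open>The independence of the number of ends from the generating set, in the form needed here. The two
  conditions replace a quasi-isometry: edges of either graph that start far enough away can be replaced
  in the other graph by walks that avoid a given finite set. Infinite components survive the removal of
  a larger finite set, so they can be compared in the second graph, and a connection found there is
  carried back to the first one.\<close>

lemma at_most_two_ends_transfer:
  assumes "sym E" and locfin: "\<And>x. finite (E `` {x})" and "sym E'"
    and forth: "\<And>F. finite F \<Longrightarrow> \<exists>F'. finite F' \<and>
      (\<forall>(p, q)\<in>E. p \<in> V - F' \<longrightarrow> q \<in> component E' (V - F) p)"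
    and back_again: "\<And>F. finite F \<Longrightarrow> \<exists>F'. finite F' \<and>
      (\<forall>(p, q)\<in>E'. p \<in> V - F' \<longrightarrow> q \<in> component E (V - F) p)"
    and two: "at_most_two_ends E' V"
  shows "at_most_two_ends E V"
  unfolding at_most_two_ends_def
proof (intro allI impI)
  fix H x y z
  assume "finite (H :: 'a set)" and fat: "infinite (component E (V - H) x)"
    "infinite (component E (V - H) y)" "infinite (component E (V - H) z)"
  obtain F where F: "finite F" "\<And>p q. (p, q) \<in> E' \<Longrightarrow> p \<in> V - F \<Longrightarrow> q \<in> component E (V - H) p"
    using back_again[OF \<open>finite H\<close>] by blast
  obtain F' where F': "finite F'" "\<And>p q. (p, q) \<in> E \<Longrightarrow> p \<in> V - F' \<Longrightarrow> q \<in> component E' (V - F) p"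
    using forth[OF \<open>finite F\<close>] by blast
  have sub: "component E' (V - F) p \<subseteq> component E (V - H) p" for p
    by (rule component_subset_component) (use F(2) in blast)
  have sub': "component E (V - H - F') p \<subseteq> component E' (V - F) p" for p
    by (rule component_subset_component) (use F'(2) in blast)
  have fat': "\<exists>p'. p' \<in> component E (V - H) p \<and> infinite (component E' (V - F) p')"
    if "infinite (component E (V - H) p)" for p
    using component_minus_finite[OF assms(1) locfin \<open>finite F'\<close> that] sub' finite_subset by blast
  obtain x' y' z' where
    in_comp: "x' \<in> component E (V - H) x" "y' \<in> component E (V - H) y"
      "z' \<in> component E (V - H) z" and
    "infinite (component E' (V - F) x')" "infinite (component E' (V - F) y')"
      "infinite (component E' (V - F) z')"
    using fat'[OF fat(1)] fat'[OF fat(2)] fat'[OF fat(3)] by blast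
  then have "y' \<in> component E' (V - F) x' \<or> z' \<in> component E' (V - F) x' \<or>
    z' \<in> component E' (V - F) y'"
    using two \<open>finite F\<close> unfolding at_most_two_ends_def by blast
  moreover have join: "q \<in> component E (V - H) p" if "q' \<in> component E' (V - F) p'"
    "p' \<in> component E (V - H) p" "q' \<in> component E (V - H) q" for p p' q q'
  proof -
    have "q' \<in> component E (V - H) p'"
      using that(1) sub by blast
    with that(2) have "q' \<in> component E (V - H) p"
      by (rule component_trans)
    then show ?thesis
      using component_sym[OF assms(1) that(3)] by (rule component_trans)
  qed
  ultimately show "y \<in> component E (V - H) x \<or> z \<in> component E (V - H) x \<or>
    z \<in> component E (V - H) y"
    using in_comp by blast
qed

lemma reachable_induce_subgraph_iff:
  "u \<rightarrow>\<^sup>*\<^bsub>\<Gamma> \<restriction> W\<^esub> v \<longleftrightarrow> u \<in> W \<and> v \<in> component (arcs_ends \<Gamma>) W u"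
proof -
  have ends: "arcs_ends (\<Gamma> \<restriction> W) = arcs_ends \<Gamma> \<inter> W \<times> W"
    by (auto simp: arcs_ends_def arc_to_ends_def)
  show ?thesis
  proof
    assume "u \<rightarrow>\<^sup>*\<^bsub>\<Gamma> \<restriction> W\<^esub> v"
    then have uv: "(u, v) \<in> rtrancl_on W (arcs_ends \<Gamma> \<inter> W \<times> W)"
      by (simp add: reachable_def ends)
    then have "v \<in> component (arcs_ends \<Gamma>) W u"
      by (induction rule: rtrancl_on_induct) (auto intro: component_step)
    with uv show "u \<in> W \<and> v \<in> component (arcs_ends \<Gamma>) W u"
      by (auto dest: in_rtrancl_on_in_F)
  next
    assume uv: "u \<in> W \<and> v \<in> component (arcs_ends \<Gamma>) W u"
    then have "(u, v) \<in> (arcs_ends \<Gamma> \<inter> W \<times> W)\<^sup>*"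
      by (simp add: component_def)
    then have "(u, v) \<in> rtrancl_on W (arcs_ends \<Gamma> \<inter> W \<times> W)"
      by (induction rule: rtrancl_induct) (use uv in \<open>auto intro: rtrancl_on_into_rtrancl_on\<close>)
    then show "u \<rightarrow>\<^sup>*\<^bsub>\<Gamma> \<restriction> W\<^esub> v"
      by (simp add: reachable_def ends)
  qed
qed

lemma infinite_component_is_infinite_component:
  assumes "sym (arcs_ends \<Gamma>)" and "infinite (component (arcs_ends \<Gamma>) W x)"
  shows "component (arcs_ends \<Gamma>) W x \<in> infinite_components (\<Gamma> \<restriction> W)"
proof -
  let ?C = "component (arcs_ends \<Gamma>) W x"
  have "x \<in> W"
    using assms(2) by (rule component_inside)
  have eq: "component (arcs_ends \<Gamma>) W u = ?C" if "u \<in> ?C" for u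
  proof
    show "component (arcs_ends \<Gamma>) W u \<subseteq> ?C"
      using component_trans[OF that] by (rule subsetI)
    show "?C \<subseteq> component (arcs_ends \<Gamma>) W u"
      using component_trans[OF component_sym[OF assms(1) that]] by (rule subsetI)
  qed
  have "?C \<subseteq> W"
    using \<open>x \<in> W\<close> by (rule component_subset)
  then have "?C \<in> pre_digraph.sccs_verts (\<Gamma> \<restriction> W)"
    unfolding pre_digraph.sccs_verts_def reachable_induce_subgraph_iff
    using eq component_refl[of x "arcs_ends \<Gamma>" W] by blast
  then show ?thesis
    using assms(2) by (simp add: infinite_components_def)
qed

lemma at_most_two_ends_if_graph_ends:
  assumes "sym (arcs_ends \<Gamma>)" and "graph_ends \<Gamma> \<le> 2"
  shows "at_most_two_ends (arcs_ends \<Gamma>) (verts \<Gamma>)"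
  unfolding at_most_two_ends_def
proof (intro allI impI)
  fix H x y z
  let ?c = "component (arcs_ends \<Gamma>) (verts \<Gamma> - H)"
  let ?I = "infinite_components (\<Gamma> \<restriction> (verts \<Gamma> - (H \<inter> verts \<Gamma>)))"
  assume "finite H" and fat: "infinite (?c x)" "infinite (?c y)" "infinite (?c z)"
  have "verts \<Gamma> - H = verts \<Gamma> - (H \<inter> verts \<Gamma>)"
    by blast
  then have sub: "{?c x, ?c y, ?c z} \<subseteq> ?I"
    using fat infinite_component_is_infinite_component[OF assms(1)] by auto
  have "ecard ?I \<le> graph_ends \<Gamma>"
    unfolding graph_ends_def using \<open>finite H\<close> by (intro SUP_upper) auto
  then have "ecard ?I \<le> 2"
    using assms(2) by (rule order_trans)
  then have "finite ?I" "card ?I \<le> 2"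
    by (auto simp: ecard_def numeral_eq_enat split: if_splits)
  then have "card {?c x, ?c y, ?c z} \<le> 2"
    using card_mono[OF _ sub] by linarith
  then have "?c x = ?c y \<or> ?c x = ?c z \<or> ?c y = ?c z"
    by (auto simp: card_insert_if split: if_splits)
  then show "y \<in> ?c x \<or> z \<in> ?c x \<or> z \<in> ?c y"
    using component_refl by metis
qed

lemma infinite_verts_if_graph_ends:
  assumes "graph_ends \<Gamma> \<noteq> 0"
  shows "infinite (verts \<Gamma>)"
proof
  assume fin: "finite (verts \<Gamma>)"
  have "infinite_components (\<Gamma> \<restriction> (verts \<Gamma> - V)) = {}" for V
  proof -
    have "finite C" if "C \<in> pre_digraph.sccs_verts (\<Gamma> \<restriction> (verts \<Gamma> - V))" for C
    proof -
      have "C \<subseteq> verts \<Gamma>"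
        using that unfolding pre_digraph.sccs_verts_def reachable_induce_subgraph_iff by blast
      then show ?thesis
        using fin finite_subset by blast
    qed
    then show ?thesis
      by (auto simp: infinite_components_def)
  qed
  then have "graph_ends \<Gamma> \<le> 0"
    unfolding graph_ends_def by (intro SUP_least) (simp add: ecard_def zero_enat_def)
  then show False
    using assms by simp
qed

section \<open>Cayley graphs\<close>

definition cayley_arcs :: "('a, 'm) monoid_scheme \<Rightarrow> 'a set \<Rightarrow> ('a \<times> 'a) set" where
  "cayley_arcs G T = arcs_ends (cayley_graph G T)"

lemma verts_cayley_graph [simp]: "verts (cayley_graph G T) = carrier G"
  by (simp add: cayley_graph_def)

lemma cayley_arcs_iff:
  "(x, y) \<in> cayley_arcs G T \<longleftrightarrow> x \<in> carrier G \<and> (\<exists>s \<in> symmetrized G T. y = x \<otimes>\<^bsub>G\<^esub> s)"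
  by (auto simp: cayley_arcs_def cayley_graph_def)

lemma (in group) symmetrized_closed: "T \<subseteq> carrier G \<Longrightarrow> s \<in> symmetrized G T \<Longrightarrow> s \<in> carrier G"
  by (auto simp: symmetrized_def)

lemma (in group) symmetrized_inv: "T \<subseteq> carrier G \<Longrightarrow> s \<in> symmetrized G T \<Longrightarrow> inv s \<in> symmetrized G T"
  by (auto simp: symmetrized_def subset_iff)

lemma (in group) sym_cayley_arcs:
  assumes "T \<subseteq> carrier G"
  shows "sym (cayley_arcs G T)"
proof (rule symI)
  fix x y assume "(x, y) \<in> cayley_arcs G T"
  then obtain s where s: "x \<in> carrier G" "s \<in> symmetrized G T" "y = x \<otimes> s"
    by (auto simp: cayley_arcs_iff)
  then have "s \<in> carrier G"
    using assms symmetrized_closed by blast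
  then have "x = y \<otimes> inv s" "y \<in> carrier G"
    using s by (simp_all add: m_assoc)
  then show "(y, x) \<in> cayley_arcs G T"
    using symmetrized_inv[OF assms s(2)] by (auto simp: cayley_arcs_iff)
qed

lemma (in group) finite_cayley_neighbours:
  assumes "finite T"
  shows "finite (cayley_arcs G T `` {x})"
proof -
  have "cayley_arcs G T `` {x} \<subseteq> (\<lambda>s. x \<otimes> s) ` symmetrized G T"
    by (auto simp: cayley_arcs_iff)
  moreover have "finite (symmetrized G T)"
    using assms by (simp add: symmetrized_def)
  ultimately show ?thesis
    using finite_surj by blast
qed

text \<open>Right translation by \<open>g\<close> is a walk along the letters of a word for \<open>g\<close>. Each letter meets \<open>F\<close> only
  when the walk starts in the preimage of \<open>F\<close> under an injective translation, so only finitely many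
  starting points are bad. Induction on \<open>g\<close> avoids mentioning words.\<close>

lemma (in group) translation_avoiding_finite:
  assumes "T \<subseteq> carrier G" and "g \<in> generate G T" and "finite F"
  shows "\<exists>F'. finite F' \<and>
    (\<forall>x \<in> carrier G - F'. x \<otimes> g \<in> component (cayley_arcs G T) (carrier G - F) x)"
proof -
  have preimage: "finite {x \<in> carrier G. x \<otimes> h \<in> F}" if "h \<in> carrier G" "finite F" for h F
  proof (rule finite_imageD)
    show "finite ((\<lambda>x. x \<otimes> h) ` {x \<in> carrier G. x \<otimes> h \<in> F})"
      using that(2) by (rule rev_finite_subset) auto
    show "inj_on (\<lambda>x. x \<otimes> h) {x \<in> carrier G. x \<otimes> h \<in> F}"
      using that(1) by (auto intro: inj_onI)
  qed
  have letter: "\<exists>F'. finite F' \<and>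
      (\<forall>x \<in> carrier G - F'. x \<otimes> g \<in> component (cayley_arcs G T) (carrier G - F) x)"
    if g: "g \<in> symmetrized G T" and "finite F" for g F
  proof (intro exI conjI ballI)
    have "g \<in> carrier G"
      using assms(1) g by (rule symmetrized_closed)
    then show "finite (F \<union> {x \<in> carrier G. x \<otimes> g \<in> F})"
      using preimage \<open>finite F\<close> by simp
    fix x assume x: "x \<in> carrier G - (F \<union> {x \<in> carrier G. x \<otimes> g \<in> F})"
    then have "(x, x \<otimes> g) \<in> cayley_arcs G T"
      using g by (auto simp: cayley_arcs_iff)
    with x \<open>g \<in> carrier G\<close> show "x \<otimes> g \<in> component (cayley_arcs G T) (carrier G - F) x"
      by (intro component_step[OF component_refl]) auto
  qed
  show ?thesis
    using assms(2,3)
  proof (induction arbitrary: F rule: generate.induct)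
    case one
    then show ?case
      by (intro exI[of _ "{}"]) simp
  next
    case (incl h)
    then show ?case
      by (intro letter) (simp_all add: symmetrized_def)
  next
    case (inv h)
    then show ?case
      by (intro letter) (simp_all add: symmetrized_def)
  next
    case (eng h1 h2)
    have closed: "h1 \<in> carrier G" "h2 \<in> carrier G"
      using eng.hyps assms(1) generate_in_carrier by blast+
    obtain F2 where F2: "finite F2"
      "\<And>x. x \<in> carrier G - F2 \<Longrightarrow> x \<otimes> h2 \<in> component (cayley_arcs G T) (carrier G - F) x"
      using eng.IH(2)[OF eng.prems] by blast
    obtain F1 where F1: "finite F1"
      "\<And>x. x \<in> carrier G - F1 \<Longrightarrow> x \<otimes> h1 \<in> component (cayley_arcs G T) (carrier G - F) x"
      using eng.IH(1)[OF eng.prems] by blast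
    show ?case
    proof (intro exI conjI ballI)
      show "finite (F1 \<union> {x \<in> carrier G. x \<otimes> h1 \<in> F2})"
        using F1(1) F2(1) closed preimage by simp
      fix x assume x: "x \<in> carrier G - (F1 \<union> {x \<in> carrier G. x \<otimes> h1 \<in> F2})"
      then have "x \<otimes> h1 \<in> component (cayley_arcs G T) (carrier G - F) x"
        using F1(2) by blast
      moreover have "x \<otimes> h1 \<otimes> h2 \<in> component (cayley_arcs G T) (carrier G - F) (x \<otimes> h1)"
        using x closed by (intro F2(2)) auto
      ultimately have "x \<otimes> h1 \<otimes> h2 \<in> component (cayley_arcs G T) (carrier G - F) x"
        by (rule component_trans)
      then show "x \<otimes> (h1 \<otimes> h2) \<in> component (cayley_arcs G T) (carrier G - F) x"
        using x closed by (simp add: m_assoc)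
    qed
  qed
qed

lemma (in group) cayley_arcs_avoiding_finite:
  assumes "finite S" and "S \<subseteq> carrier G" and T: "T \<subseteq> carrier G" "generate G T = carrier G"
    and "finite F"
  shows "\<exists>F'. finite F' \<and> (\<forall>(p, q)\<in>cayley_arcs G S. p \<in> carrier G - F' \<longrightarrow>
    q \<in> component (cayley_arcs G T) (carrier G - F) p)"
proof -
  have "\<forall>s \<in> symmetrized G S. \<exists>F'. finite F' \<and>
    (\<forall>x \<in> carrier G - F'. x \<otimes> s \<in> component (cayley_arcs G T) (carrier G - F) x)"
  proof
    fix s assume "s \<in> symmetrized G S"
    then have "s \<in> generate G T"
      using symmetrized_closed[OF assms(2)] T(2) by simp
    with T(1) show "\<exists>F'. finite F' \<and>
        (\<forall>x \<in> carrier G - F'. x \<otimes> s \<in> component (cayley_arcs G T) (carrier G - F) x)"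
      using \<open>finite F\<close> by (rule translation_avoiding_finite)
  qed
  then obtain f where f: "\<And>s. s \<in> symmetrized G S \<Longrightarrow> finite (f s)"
    "\<And>s x. s \<in> symmetrized G S \<Longrightarrow> x \<in> carrier G - f s \<Longrightarrow>
      x \<otimes> s \<in> component (cayley_arcs G T) (carrier G - F) x"
    by metis
  show ?thesis
  proof (intro exI conjI ballI)
    show "finite (\<Union>s \<in> symmetrized G S. f s)"
      using f(1) assms(1) by (auto simp: symmetrized_def)
    fix e assume "e \<in> cayley_arcs G S"
    then show "case e of (p, q) \<Rightarrow> p \<in> carrier G - (\<Union>s \<in> symmetrized G S. f s) \<longrightarrow>
        q \<in> component (cayley_arcs G T) (carrier G - F) p"
      using f(2) by (auto simp: cayley_arcs_iff)
  qed
qed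

lemma (in group) cayley_connected:
  assumes "T \<subseteq> carrier G" and "generate G T = carrier G"
    and "x \<in> carrier G" and "y \<in> carrier G"
  shows "y \<in> component (cayley_arcs G T) (carrier G) x"
proof -
  have step: "x \<otimes> s \<in> component (cayley_arcs G T) (carrier G) x"
    if "x \<in> carrier G" "s \<in> symmetrized G T" for x s
  proof (rule component_step[OF component_refl])
    show "(x, x \<otimes> s) \<in> cayley_arcs G T"
      using that by (auto simp: cayley_arcs_iff)
    show "x \<in> carrier G" "x \<otimes> s \<in> carrier G"
      using that symmetrized_closed[OF assms(1) that(2)] by simp_all
  qed
  have "x \<otimes> g \<in> component (cayley_arcs G T) (carrier G) x"
    if "g \<in> generate G T" "x \<in> carrier G" for g x
    using that
  proof (induction arbitrary: x rule: generate.induct)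
    case (eng h1 h2)
    have "h1 \<in> carrier G" "h2 \<in> carrier G"
      using eng.hyps assms(1) generate_in_carrier by blast+
    then have "x \<otimes> (h1 \<otimes> h2) = x \<otimes> h1 \<otimes> h2" "x \<otimes> h1 \<in> carrier G"
      using eng.prems by (simp_all add: m_assoc)
    then show ?case
      using component_trans[OF eng.IH(1)[OF eng.prems] eng.IH(2)] by simp
  qed (auto simp: symmetrized_def intro!: step)
  from this[of "inv x \<otimes> y" x] show ?thesis
    using assms by (simp add: m_assoc[symmetric])
qed

lemma (in group) word_value_closed:
  "T \<subseteq> carrier G \<Longrightarrow> set w \<subseteq> symmetrized G T \<Longrightarrow> word_value G w \<in> carrier G"
  by (induction w) (auto simp: word_value_def dest: symmetrized_closed)

lemma (in group) cayley_walk_word: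
  assumes "T \<subseteq> carrier G" and "x \<in> carrier G" and "(x, y) \<in> ((cayley_arcs G T)\<^sup>=) ^^ n"
  shows "\<exists>w. set w \<subseteq> symmetrized G T \<and> length w \<le> n \<and> y = x \<otimes> word_value G w"
  using assms(2,3)
proof (induction n arbitrary: x)
  case 0
  then show ?case
    by (intro exI[of _ "[]"]) (simp add: word_value_def)
next
  case (Suc n)
  obtain z where z: "(x, z) \<in> (cayley_arcs G T)\<^sup>=" "(z, y) \<in> ((cayley_arcs G T)\<^sup>=) ^^ n"
    using relpow_Suc_D2[OF Suc.prems(2)] by blast
  show ?case
  proof (cases "z = x")
    case True
    then obtain w where "set w \<subseteq> symmetrized G T" "length w \<le> n" "y = x \<otimes> word_value G w"
      using Suc.IH[OF Suc.prems(1)] z(2) by blast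
    then show ?thesis
      by (intro exI[of _ w]) simp
  next
    case False
    then obtain s where s: "s \<in> symmetrized G T" "z = x \<otimes> s"
      using z(1) by (auto simp: cayley_arcs_iff)
    then have closed: "s \<in> carrier G" "z \<in> carrier G"
      using symmetrized_closed[OF assms(1)] Suc.prems(1) by auto
    then obtain w where w: "set w \<subseteq> symmetrized G T" "length w \<le> n" "y = z \<otimes> word_value G w"
      using Suc.IH z(2) by blast
    moreover have "word_value G (s # w) = s \<otimes> word_value G w"
      by (simp add: word_value_def)
    ultimately show ?thesis
      using s closed Suc.prems(1) word_value_closed[OF assms(1) w(1)]
      by (intro exI[of _ "s # w"]) (simp add: m_assoc)
  qed
qed

text \<open>The arc is labelled by the value \<open>s\<close> of a word of length at most \<open>n\<close>. The same word witnesses that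
  \<open>inv s\<close> lies in the ball, because the distance is measured towards the unit; as arcs may be
  labelled by inverses of generators, \<open>s = inv (inv s)\<close> is an admissible label.\<close>

lemma (in group) cayley_walk_arc:
  assumes "T \<subseteq> carrier G" and "x \<in> carrier G" and "(x, y) \<in> ((cayley_arcs G T)\<^sup>=) ^^ n"
  shows "(x, y) \<in> cayley_arcs G {g \<in> carrier G. word_dist G T g \<one> \<le> n}"
proof -
  obtain w where w: "set w \<subseteq> symmetrized G T" "length w \<le> n" "y = x \<otimes> word_value G w"
    using cayley_walk_word[OF assms] by blast
  define s where "s = word_value G w"
  have s: "s \<in> carrier G"
    unfolding s_def using assms(1) w(1) by (rule word_value_closed)
  have "word_dist G T (inv s) \<one> \<le> length w"
    unfolding word_dist_def using w(1) s by (intro Least_le exI[of _ w]) (simp add: s_def)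
  then have "inv s \<in> {g \<in> carrier G. word_dist G T g \<one> \<le> n}"
    using w(2) s by simp
  then have "inv (inv s) \<in> symmetrized G {g \<in> carrier G. word_dist G T g \<one> \<le> n}"
    unfolding symmetrized_def by blast
  then show ?thesis
    using w(3) s assms(2) by (auto simp: cayley_arcs_iff s_def)
qed

text \<open>\<open>group_ends\<close> is defined by an unspecified finite generating set \<open>T\<close>. Each of the Cayley graphs of
  \<open>S\<close> and \<open>T\<close> has walks for the edges of the other one, and far from a finite set these walks avoid it.\<close>

lemma (in group) at_most_two_ends_cayley:
  assumes "group_ends G \<le> 2" and "finite_generating_set G S"
  shows "at_most_two_ends (cayley_arcs G S) (carrier G)"
proof -
  define T where "T = (SOME T. finite_generating_set G T)"
  have "finite_generating_set G T"
    using assms(2) unfolding T_def by (rule someI)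
  then have T: "finite T" "T \<subseteq> carrier G" "generate G T = carrier G"
    by (auto simp: finite_generating_set_def)
  have S: "finite S" "S \<subseteq> carrier G" "generate G S = carrier G"
    using assms(2) by (auto simp: finite_generating_set_def)
  have ends: "graph_ends (cayley_graph G T) \<le> 2"
    using assms(1) by (simp add: group_ends_def T_def)
  show ?thesis
  proof (rule at_most_two_ends_transfer)
    show "at_most_two_ends (cayley_arcs G T) (carrier G)"
      using at_most_two_ends_if_graph_ends[OF _ ends] sym_cayley_arcs[OF T(2)]
      by (simp add: cayley_arcs_def)
    show "\<exists>F'. finite F' \<and> (\<forall>(p, q)\<in>cayley_arcs G S. p \<in> carrier G - F' \<longrightarrow>
        q \<in> component (cayley_arcs G T) (carrier G - F) p)" if "finite F" for F
      using S(1,2) T(2,3) that by (rule cayley_arcs_avoiding_finite)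
    show "\<exists>F'. finite F' \<and> (\<forall>(p, q)\<in>cayley_arcs G T. p \<in> carrier G - F' \<longrightarrow>
        q \<in> component (cayley_arcs G S) (carrier G - F) p)" if "finite F" for F
      using T(1,2) S(2,3) that by (rule cayley_arcs_avoiding_finite)
    show "sym (cayley_arcs G S)" "sym (cayley_arcs G T)"
      using S(2) T(2) by (auto intro: sym_cayley_arcs)
    show "finite (cayley_arcs G S `` {x})" for x
      using S(1) by (rule finite_cayley_neighbours)
  qed
qed

section \<open>Tours with jumps of length at most three\<close>

lemma sym_relpow: "sym R \<Longrightarrow> sym (R ^^ n)"
proof (induction n)
  case (Suc n)
  show ?case
  proof (rule symI)
    fix x y assume "(x, y) \<in> R ^^ Suc n"
    then obtain z where "(x, z) \<in> R ^^ n" "(z, y) \<in> R"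
      by auto
    then have "(y, z) \<in> R" "(z, x) \<in> R ^^ n"
      using Suc by (auto dest: symD)
    then show "(y, x) \<in> R ^^ Suc n"
      by (rule relpow_Suc_I2)
  qed
qed (simp add: sym_def)

text \<open>Sekanina's argument. Cut off a branch at the root: the tour of the rest ends at the root or at a
  neighbour of it, the reversed tour of the branch starts at its root \<open>c\<close> or at a neighbour of \<open>c\<close>,
  and \<open>c\<close> is a neighbour of \<open>r\<close>, so the jump between the two tours has length at most three. The
  reversed tour ends at \<open>c\<close>, which gives the condition on the last vertex again.\<close>

lemma rooted_tour:
  assumes "sym E" and "finite T" and "r \<in> T" and "T \<subseteq> component E T r"
  shows "\<exists>h. distinct h \<and> set h = T \<and> h \<noteq> [] \<and> hd h = r \<and> (last h, r) \<in> E\<^sup>= \<and>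
    successively (\<lambda>x y. (x, y) \<in> (E\<^sup>=) ^^ 3) h"
  using assms(2-)
proof (induction "card T" arbitrary: T r rule: less_induct)
  case less
  show ?case
  proof (cases "T = {r}")
    case True
    then show ?thesis
      by (intro exI[of _ "[r]"]) auto
  next
    case False
    with less.prems obtain w where "w \<in> component E T r" "w \<noteq> r"
      by blast
    then obtain c where c: "(r, c) \<in> E" "c \<in> T - {r}"
      by (rule component_remove_root)
    define T2 where "T2 = component E (T - {r}) c"
    define T1 where "T1 = T - T2"
    have T2: "T2 \<subseteq> T - {r}" "c \<in> T2"
      using c component_subset[of c "T - {r}" E] unfolding T2_def by auto
    have "T2 \<subseteq> component E T2 c"
      using component_connected_from[OF assms(1) c(2) component_refl] by (simp add: T2_def)
    moreover have "card T2 < card T"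
      using T2 less.prems by (intro psubset_card_mono) auto
    moreover have "finite T2"
      using T2 less.prems by (auto intro: finite_subset)
    ultimately obtain h2 where h2: "distinct h2" "set h2 = T2" "h2 \<noteq> []" "hd h2 = c"
      "(last h2, c) \<in> E\<^sup>=" "successively (\<lambda>x y. (x, y) \<in> (E\<^sup>=) ^^ 3) h2"
      using less.hyps[of T2 c] T2(2) by blast
    have "r \<in> T1"
      using T2 less.prems by (auto simp: T1_def)
    have "T1 \<subseteq> component E T1 r"
      using connected_without_component[OF assms(1) less.prems(2,3) c(2)]
      by (simp add: T1_def T2_def)
    moreover have "card T1 < card T"
      using T2 less.prems by (intro psubset_card_mono) (auto simp: T1_def)
    moreover have "finite T1"
      using less.prems by (auto simp: T1_def)
    ultimately obtain h1 where h1: "distinct h1" "set h1 = T1" "h1 \<noteq> []" "hd h1 = r"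
      "(last h1, r) \<in> E\<^sup>=" "successively (\<lambda>x y. (x, y) \<in> (E\<^sup>=) ^^ 3) h1"
      using less.hyps[of T1 r] \<open>r \<in> T1\<close> by blast
    have "sym ((E\<^sup>=) ^^ 3)"
      using assms(1) by (intro sym_relpow) (auto simp: sym_def)
    then have rev: "successively (\<lambda>x y. (x, y) \<in> (E\<^sup>=) ^^ 3) (rev h2)"
      using h2(6) by (auto simp: sym_def elim!: successively_mono)
    \<comment> \<open>The jump: \<open>last h1\<close> to \<open>r\<close>, \<open>r\<close> to \<open>c\<close>, \<open>c\<close> to \<open>last h2\<close>.\<close>
    have "(c, last h2) \<in> E\<^sup>="
      using h2(5) assms(1) by (auto dest: symD)
    then have "(last h1, last h2) \<in> (E\<^sup>=) ^^ 3"
      using h1(5) c(1) by (auto simp: numeral_3_eq_3)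
    then have "successively (\<lambda>x y. (x, y) \<in> (E\<^sup>=) ^^ 3) (h1 @ rev h2)"
      using h1 h2 rev by (auto simp: successively_append_iff hd_rev)
    moreover have "(last (rev h2), r) \<in> E\<^sup>="
      using c(1) h2 assms(1) by (auto simp: last_rev dest: symD)
    ultimately show ?thesis
      using h1 h2 T2 by (intro exI[of _ "h1 @ rev h2"]) (auto simp: T1_def)
  qed
qed

text \<open>The infinite concatenation of the blocks, read off from the finite stages.\<close>

lemma growing_list_enumeration:
  fixes L :: "nat \<Rightarrow> 'a list"
  assumes grow: "\<And>k. \<exists>h. h \<noteq> [] \<and> L (Suc k) = L k @ h"
    and dist: "\<And>k. distinct (L k)"
    and succ: "\<And>k. successively P (L k)"
    and nonempty: "L 0 \<noteq> []"
  obtains q :: "nat \<Rightarrow> 'a" where "bij_betw q UNIV (\<Union>k. set (L k))" and "q 0 = hd (L 0)"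
    and "\<And>n. P (q n) (q (Suc n))"
proof -
  have long: "k < length (L k)" for k
  proof (induction k)
    case 0
    then show ?case using nonempty by simp
  next
    case (Suc k)
    obtain h where "h \<noteq> []" "L (Suc k) = L k @ h"
      using grow by blast
    then show ?case
      using Suc by (cases h) auto
  qed
  have stable: "j < length (L k) \<and> L k ! j = L m ! j" if "k \<ge> m" "j < length (L m)" for k m j
    using that(1)
  proof (induction k rule: dec_induct)
    case base
    then show ?case using that by simp
  next
    case (step k)
    obtain h where "L (Suc k) = L k @ h"
      using grow by blast
    with step show ?case
      by (simp add: nth_append)
  qed
  define q where "q n = L n ! n" for n
  have q: "q n = L k ! n" if "n < length (L k)" for n k
    using stable[of n k n] stable[of k n n] long[of n] that by (cases "n \<le> k") (auto simp: q_def)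
  have "inj q"
  proof (rule injI)
    fix m n assume "q m = q n"
    define k where "k = max m n"
    have "m < length (L k)" "n < length (L k)"
      using long[of k] by (auto simp: k_def)
    with \<open>q m = q n\<close> dist show "m = n"
      by (simp add: q nth_eq_iff_index_eq)
  qed
  moreover have "range q = (\<Union>k. set (L k))"
  proof
    show "range q \<subseteq> (\<Union>k. set (L k))"
      using long by (auto simp: q_def)
    show "(\<Union>k. set (L k)) \<subseteq> range q"
    proof
      fix x assume "x \<in> (\<Union>k. set (L k))"
      then obtain k n where "n < length (L k)" "x = L k ! n"
        by (auto simp: in_set_conv_nth)
      then have "x = q n"
        by (simp add: q)
      then show "x \<in> range q"
        by simp
    qed
  qed
  moreover have "P (q n) (q (Suc n))" for n
    using long[of "Suc n"] q[of n "Suc n"] q[of "Suc n" "Suc n"] successively_nth[OF succ, of n "Suc n"]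
    by simp
  moreover have "q 0 = hd (L 0)"
    using nonempty by (simp add: q_def hd_conv_nth)
  ultimately show thesis
    using that by (simp add: bij_betw_def)
qed

text \<open>The tour of a piece ends within distance one of its root, and the next root is within distance two
  of that root. Concatenating the tours thus gives jumps of length at most three.\<close>

lemma ray_through_pieces:
  fixes T :: "nat \<Rightarrow> 'a set"
  assumes "sym E"
    and fin: "\<And>i. finite (T i)" and root: "\<And>i. r i \<in> T i"
    and conn: "\<And>i. T i \<subseteq> component E (T i) (r i)"
    and disj: "disjoint_family T"
    and near: "\<And>i. (r i, r (Suc i)) \<in> (E\<^sup>=) ^^ 2"
  obtains q where "bij_betw q UNIV (\<Union>i. T i)" and "q 0 = r 0"
    and "\<And>n. (q n, q (Suc n)) \<in> (E\<^sup>=) ^^ 3"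
proof -
  have "\<forall>i. \<exists>h. distinct h \<and> set h = T i \<and> h \<noteq> [] \<and> hd h = r i \<and> (last h, r i) \<in> E\<^sup>= \<and>
    successively (\<lambda>x y. (x, y) \<in> (E\<^sup>=) ^^ 3) h"
    using rooted_tour[OF assms(1) fin root conn] by blast
  then obtain h where h: "\<And>i. distinct (h i)" "\<And>i. set (h i) = T i" "\<And>i. h i \<noteq> []"
    "\<And>i. hd (h i) = r i" "\<And>i. (last (h i), r i) \<in> E\<^sup>="
    "\<And>i. successively (\<lambda>x y. (x, y) \<in> (E\<^sup>=) ^^ 3) (h i)"
    by metis
  define L where "L k = concat (map h [0..<Suc k])" for k
  have L_Suc: "L (Suc k) = L k @ h (Suc k)" for k
    by (simp add: L_def)
  have L_set: "set (L k) = (\<Union>i\<le>k. T i)" for k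
    by (induction k) (use h(2) in \<open>auto simp: L_Suc L_def atMost_Suc\<close>)
  have L_last: "L k \<noteq> [] \<and> last (L k) = last (h k)" for k
    using h(3) by (cases k) (simp_all add: L_def)
  \<comment> \<open>One step back to the root \<open>r k\<close>, then two steps to the next root.\<close>
  have jump: "(last (h k), r (Suc k)) \<in> (E\<^sup>=) ^^ 3" for k
  proof -
    have "(last (h k), r (Suc k)) \<in> (E\<^sup>=) ^^ 1 O (E\<^sup>=) ^^ 2"
      by (rule relcompI[OF _ near]) (use h(5)[of k] in simp)
    moreover have "(3::nat) = 1 + 2"
      by simp
    ultimately show ?thesis
      by (simp only: relpow_add)
  qed
  obtain q where q: "bij_betw q UNIV (\<Union>k. set (L k))" "q 0 = hd (L 0)"
    "\<And>n. (q n, q (Suc n)) \<in> (E\<^sup>=) ^^ 3"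
  proof (rule growing_list_enumeration[of L "\<lambda>x y. (x, y) \<in> (E\<^sup>=) ^^ 3"])
    show "\<exists>ha. ha \<noteq> [] \<and> L (Suc k) = L k @ ha" for k
      using L_Suc h(3) by blast
    show "distinct (L k)" for k
    proof (induction k)
      case 0
      then show ?case using h(1) by (simp add: L_def)
    next
      case (Suc k)
      have "T i \<inter> T (Suc k) = {}" if "i \<le> k" for i
        using disj that by (auto simp: disjoint_family_on_def)
      then show ?case
        using Suc h(1,2) by (auto simp: L_Suc L_set)
    qed
    show "successively (\<lambda>x y. (x, y) \<in> (E\<^sup>=) ^^ 3) (L k)" for k
    proof (induction k)
      case 0
      then show ?case using h(6) by (simp add: L_def)
    next
      case (Suc k)
      then show ?case
        using h(4,6) jump[of k] L_last by (simp add: L_Suc successively_append_iff)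
    qed
    show "L 0 \<noteq> []"
      using L_last by blast
  qed blast
  moreover have "(\<Union>k. set (L k)) = (\<Union>i. T i)"
    using L_set by auto
  moreover have "hd (L 0) = r 0"
    using h(4) by (simp add: L_def)
  ultimately show thesis
    using that by simp
qed

lemma glue_rays:
  fixes q q' :: "nat \<Rightarrow> 'a"
  assumes "bij_betw q UNIV A" and "bij_betw q' UNIV B" and "A \<inter> B = {}"
    and "symp P" and "P (q' 0) (q 0)"
    and "\<And>n. P (q n) (q (Suc n))" and "\<And>n. P (q' n) (q' (Suc n))"
  obtains p :: "int \<Rightarrow> 'a" where "bij_betw p UNIV (A \<union> B)" and "\<And>i. P (p i) (p (i + 1))"
proof -
  define p where "p i = (if i \<ge> 0 then q (nat i) else q' (nat (- i - 1)))" for i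
  have "bij_betw p {0..} A"
  proof -
    have "bij_betw nat {0..} UNIV"
      by (rule bij_betwI[of _ _ _ int]) auto
    then have "bij_betw (q \<circ> nat) {0..} A"
      using assms(1) by (rule bij_betw_trans)
    then show ?thesis
      by (rule bij_betw_cong[THEN iffD1, rotated]) (auto simp: p_def)
  qed
  moreover have "bij_betw p {..<0} B"
  proof -
    have "bij_betw (\<lambda>i. nat (- i - 1)) {..<0} UNIV"
      by (rule bij_betwI[of _ _ _ "\<lambda>n. - int n - 1"]) auto
    then have "bij_betw (q' \<circ> (\<lambda>i. nat (- i - 1))) {..<0} B"
      using assms(2) by (rule bij_betw_trans)
    then show ?thesis
      by (rule bij_betw_cong[THEN iffD1, rotated]) (auto simp: p_def)
  qed
  ultimately have "bij_betw p ({0..} \<union> {..<0}) (A \<union> B)"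
    using assms(3) by (rule bij_betw_combine)
  moreover have "{0..} \<union> {..<0} = (UNIV :: int set)"
    by auto
  moreover have "P (p i) (p (i + 1))" for i
  proof -
    consider "i \<ge> 0" | "i = -1" | "i < -1"
      by linarith
    then show ?thesis
    proof cases
      case 1
      then show ?thesis
        using assms(6)[of "nat i"] by (simp add: p_def nat_add_distrib)
    next
      case 2
      then show ?thesis
        using assms(5) by (simp add: p_def)
    next
      case 3
      define m where "m = nat (- (i + 1) - 1)"
      have "p i = q' (Suc m)" "p (i + 1) = q' m"
        using 3 by (auto simp: p_def m_def intro!: arg_cong[of _ _ q'])
      then show ?thesis
        using assms(7)[of m] assms(4) by (simp add: sympD)
    qed
  qed
  ultimately show thesis
    using that by simp
qed

section \<open>Cutting a one-ended graph into finite pieces\<close>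

definition at_most_one_end :: "('a \<times> 'a) set \<Rightarrow> 'a set \<Rightarrow> bool" where
  "at_most_one_end E C \<longleftrightarrow> (\<forall>H x y. finite H \<longrightarrow>
     infinite (component E (C - H) x) \<longrightarrow> infinite (component E (C - H) y) \<longrightarrow>
     y \<in> component E (C - H) x)"

lemma at_most_one_end_minus:
  assumes "at_most_one_end E C" and "finite H"
  shows "at_most_one_end E (C - H)"
  unfolding at_most_one_end_def
proof (intro allI impI)
  fix H' x y
  assume "finite (H' :: 'a set)" "infinite (component E (C - H - H') x)"
    "infinite (component E (C - H - H') y)"
  moreover have "C - H - H' = C - (H \<union> H')"
    by blast
  ultimately show "y \<in> component E (C - H - H') x"
    using assms unfolding at_most_one_end_def by (metis finite_UnI)
qed

definition dist_in :: "('a \<times> 'a) set \<Rightarrow> 'a set \<Rightarrow> 'a \<Rightarrow> 'a \<Rightarrow> nat" where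
  "dist_in E U x y = (LEAST n. (x, y) \<in> (E \<inter> U \<times> U) ^^ n)"

text \<open>One step of a depth-first search. Removing \<open>r\<close> from a one-ended set \<open>U\<close> leaves exactly one infinite
  component \<open>D\<close>; the finite components, finitely many because \<open>r\<close> has finite degree, form together
  with \<open>r\<close> a finite connected piece. The new root is the vertex after \<open>r\<close> on a shortest walk in \<open>U\<close>
  from \<open>r\<close> to the target. That walk does not come back to \<open>r\<close>, so from there on it stays in \<open>D\<close>. The
  target may depend on \<open>D\<close>, since it is chosen among the vertices that survive the step.\<close>

lemma prune_root:
  assumes "sym E" and locfin: "\<And>x. finite (E `` {x})"
    and "infinite U" and "r \<in> U" and conn: "U \<subseteq> component E U r"
    and one: "at_most_one_end E U"
    and target: "\<And>D. D \<noteq> {} \<Longrightarrow> target D \<in> D"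
  obtains D r' where "infinite D" and "r' \<in> D" and "D \<subseteq> component E D r'"
    and "at_most_one_end E D" and "D \<subseteq> U - {r}" and "finite (U - D)"
    and "U - D \<subseteq> component E (U - D) r" and "(r, r') \<in> E"
    and "dist_in E D r' (target D) < dist_in E U r (target D)"
proof -
  have "infinite (component E U r)"
    using conn assms(3) finite_subset by blast
  then obtain c where c: "infinite (component E (U - {r}) c)"
    using component_minus_finite[OF assms(1) locfin, of "{r}" U r] by auto
  define D where "D = component E (U - {r}) c"
  have c_in: "c \<in> U - {r}"
    using c by (rule component_inside)
  have D_sub: "D \<subseteq> U - {r}"
    unfolding D_def using c_in by (rule component_subset)
  have D_eq: "(U - {r}) \<inter> D = D"
    using D_sub by blast
  have D_closed: "q \<in> D" if "p \<in> D" "(p, q) \<in> E" "p \<in> U - {r}" "q \<in> U - {r}" for p q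
    using that unfolding D_def by (rule component_step)
  have "finite (\<Union>n \<in> E `` {r} - D. component E (U - {r}) n)"
  proof (intro finite_UN_I)
    show "finite (E `` {r} - D)"
      using locfin by simp
    fix n assume "n \<in> E `` {r} - D"
    then show "finite (component E (U - {r}) n)"
      using one c unfolding at_most_one_end_def D_def by blast
  qed
  moreover have "U - D \<subseteq> insert r (\<Union>n \<in> E `` {r} - D. component E (U - {r}) n)"
  proof
    fix z assume z: "z \<in> U - D"
    show "z \<in> insert r (\<Union>n \<in> E `` {r} - D. component E (U - {r}) n)"
    proof (cases "z = r")
      case False
      from z conn have "z \<in> component E U r"
        by blast
      then obtain n where n: "(r, n) \<in> E" "z \<in> component E (U - {r}) n"
        using False by (rule component_remove_root)
      moreover from this z have "n \<notin> D"
        using component_trans[of n E "U - {r}" c z] by (auto simp: D_def)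
      ultimately show ?thesis
        by blast
    qed simp
  qed
  ultimately have fin: "finite (U - D)"
    using finite_subset by blast
  have "U - (U - D) = D"
    using D_sub by blast
  then have one': "at_most_one_end E D"
    using at_most_one_end_minus[OF one fin] by simp
  define w where "w = target D"
  have w: "w \<in> D"
    using target[of D] by (auto simp: w_def D_def intro: component_refl)
  then have "w \<in> component E U r"
    using D_sub conn by blast
  then have "\<exists>n. (r, w) \<in> (E \<inter> U \<times> U) ^^ n"
    by (auto simp: component_def rtrancl_power)
  then have "(r, w) \<in> (E \<inter> U \<times> U) ^^ dist_in E U r w"
    unfolding dist_in_def by (rule LeastI_ex)
  then obtain m r' where m: "m < dist_in E U r w" "(r, r') \<in> E" "r' \<in> U - {r}"
    "(r', w) \<in> (E \<inter> (U - {r}) \<times> (U - {r})) ^^ m"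
    using leave_root[where E = E and U = U and r = r and w = w] w D_sub by blast
  have "w \<in> component E (U - {r}) r'"
    using m(4) by (auto simp: component_def dest: relpow_imp_rtrancl)
  then have r': "r' \<in> D"
    using w component_sym[OF assms(1)] component_trans unfolding D_def by metis
  have "(r', w) \<in> (E \<inter> ((U - {r}) \<inter> D) \<times> ((U - {r}) \<inter> D)) ^^ m"
    using relpow_confined[OF m(4) r'] D_closed by blast
  then have "dist_in E D r' w \<le> m"
    unfolding D_eq dist_in_def by (rule Least_le)
  with m(1) have "dist_in E D r' (target D) < dist_in E U r (target D)"
    by (simp add: w_def)
  moreover have "D \<subseteq> component E D r'"
    using component_connected_from[OF assms(1) c_in] r' unfolding D_def by blast
  moreover have "U - D \<subseteq> component E (U - D) r"
    using connected_without_component[OF assms(1,4) conn c_in] by (simp add: D_def)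
  moreover have "infinite D"
    using c by (simp add: D_def)
  ultimately show thesis
    using that fin one' D_sub r' m(2) by blast
qed

lemma countable_component:
  assumes "\<And>x. finite (E `` {x})"
  shows "countable (component E A x)"
proof -
  have "finite (((E \<inter> A \<times> A) ^^ n) `` {x})" for n
  proof (induction n)
    case (Suc n)
    have "((E \<inter> A \<times> A) ^^ Suc n) `` {x} \<subseteq> (\<Union>y \<in> ((E \<inter> A \<times> A) ^^ n) `` {x}. E `` {y})"
      by auto
    with Suc show ?case
      using assms by (meson finite_UN_I finite_subset)
  qed simp
  moreover have "component E A x = (\<Union>n. ((E \<inter> A \<times> A) ^^ n) `` {x})"
    by (auto simp: component_def rtrancl_power)
  ultimately show ?thesis
    by (simp add: countable_finite)
qed

text \<open>Iterating \<open>prune_root\<close> peels off finite pieces. To use up every vertex, the target is always the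
  first surviving vertex of a fixed enumeration of \<open>C\<close>: if a vertex \<open>w\<close> survived forever and were
  the first such, then from some stage on \<open>w\<close> would be the target at every step, and the distance from
  the root to \<open>w\<close> would decrease forever.\<close>

lemma one_ended_pieces:
  assumes "sym E" and locfin: "\<And>x. finite (E `` {x})"
    and "infinite C" and "a \<in> C" and conn: "C \<subseteq> component E C a"
    and one: "at_most_one_end E C"
  obtains T r where "\<And>i. finite (T i)" and "\<And>i. r i \<in> T i"
    and "\<And>i. T i \<subseteq> component E (T i) (r i)" and "\<And>i. (r i, r (Suc i)) \<in> E"
    and "disjoint_family T" and "(\<Union>i. T i) = C" and "r 0 = a"
proof -
  have "countable C"
    by (rule countable_subset[OF conn countable_component[OF locfin]])
  define idx where "idx = to_nat_on C"
  have inj: "inj_on idx C"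
    unfolding idx_def using \<open>countable C\<close> by (rule inj_on_to_nat_on)
  define target where "target D = arg_min idx (\<lambda>x. x \<in> D)" for D :: "'a set"
  have target: "target D \<in> D" if "D \<noteq> {}" for D
    unfolding target_def using that arg_min_natI by (metis ex_in_conv)
  have target_le: "idx (target D) \<le> idx x" if "x \<in> D" for D x
    unfolding target_def using arg_min_nat_le[of "\<lambda>x. x \<in> D"] that by metis
  define ok where "ok = (\<lambda>(U, r). infinite U \<and> r \<in> U \<and> U \<subseteq> component E U r \<and>
    at_most_one_end E U)"
  define nxt where "nxt = (\<lambda>(U, r) (D, r'). D \<subseteq> U - {r} \<and> finite (U - D) \<and>
    U - D \<subseteq> component E (U - D) r \<and> (r, r') \<in> E \<and>
    dist_in E D r' (target D) < dist_in E U r (target D))"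
  have "\<exists>f. \<forall>n. ((n = 0 \<longrightarrow> f n = (C, a)) \<and> ok (f n)) \<and> nxt (f n) (f (Suc n))"
  proof (rule dependent_nat_choice)
    show "\<exists>x. (0 = (0::nat) \<longrightarrow> x = (C, a)) \<and> ok x"
      using assms by (auto simp: ok_def)
    fix x and n :: nat
    assume "(n = 0 \<longrightarrow> x = (C, a)) \<and> ok x"
    then obtain U r where "x = (U, r)" "infinite U" "r \<in> U" "U \<subseteq> component E U r"
      "at_most_one_end E U"
      by (auto simp: ok_def)
    note U = this
    obtain D r' where "infinite D" "r' \<in> D" "D \<subseteq> component E D r'" "at_most_one_end E D"
      "D \<subseteq> U - {r}" "finite (U - D)" "U - D \<subseteq> component E (U - D) r" "(r, r') \<in> E"
      "dist_in E D r' (target D) < dist_in E U r (target D)"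
      by (rule prune_root[where target = target, OF assms(1) locfin U(2-5) target])
    then have "((Suc n = 0 \<longrightarrow> (D, r') = (C, a)) \<and> ok (D, r')) \<and> nxt x (D, r')"
      by (simp add: ok_def nxt_def U(1))
    then show "\<exists>y. ((Suc n = 0 \<longrightarrow> y = (C, a)) \<and> ok y) \<and> nxt x y" ..
  qed
  then obtain f where f: "f 0 = (C, a)" "\<And>n. ok (f n)" "\<And>n. nxt (f n) (f (Suc n))"
    by blast
  define U where "U n = fst (f n)" for n
  define r where "r n = snd (f n)" for n
  define T where "T n = U n - U (Suc n)" for n
  have f_eq: "f n = (U n, r n)" for n
    by (simp add: U_def r_def)
  have ok: "infinite (U n)" "r n \<in> U n" for n
    using f(2)[of n] by (auto simp: f_eq ok_def)
  have nxt: "U (Suc n) \<subseteq> U n - {r n}" "finite (T n)" "T n \<subseteq> component E (T n) (r n)"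
    "(r n, r (Suc n)) \<in> E"
    "dist_in E (U (Suc n)) (r (Suc n)) (target (U (Suc n))) < dist_in E (U n) (r n) (target (U (Suc n)))"
    for n
    using f(3)[of n] by (auto simp: f_eq nxt_def T_def)
  have start: "U 0 = C" "r 0 = a"
    using f(1) by (auto simp: f_eq)
  have U_anti: "U n \<subseteq> U m" if "m \<le> n" for m n
    using that by (induction rule: dec_induct) (use nxt(1) in auto)
  have exhausted: "\<exists>n. w \<notin> U n" if "w \<in> C" for w
    using that
  proof (induction "idx w" arbitrary: w rule: less_induct)
    case less
    show ?case
    proof (rule ccontr)
      assume "\<not> ?case"
      then have w: "w \<in> U n" for n
        by blast
      \<comment> \<open>The finitely many vertices before \<open>w\<close>, all of which are eventually used up.\<close>
      define S where "S = {x \<in> C. idx x < idx w}"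
      have "finite S"
        using inj unfolding S_def
        by (intro finite_imageD[of idx]) (auto intro: finite_subset[of _ "{..<idx w}"] inj_on_subset)
      moreover have "\<forall>x\<in>S. \<forall>\<^sub>F n in sequentially. x \<notin> U n"
      proof
        fix x assume "x \<in> S"
        then obtain m where "x \<notin> U m"
          using less by (auto simp: S_def)
        then show "\<forall>\<^sub>F n in sequentially. x \<notin> U n"
          using U_anti by (auto simp: eventually_sequentially)
      qed
      ultimately have "\<forall>\<^sub>F n in sequentially. \<forall>x\<in>S. x \<notin> U n"
        by (rule eventually_ball_finite)
      then obtain N where N: "\<And>n x. n \<ge> N \<Longrightarrow> x \<in> S \<Longrightarrow> x \<notin> U n"
        by (auto simp: eventually_sequentially)
      have "target (U n) = w" if "n \<ge> N" for n
      proof -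
        have "target (U n) \<in> U n"
          using w[of n] by (intro target) auto
        moreover from this have "target (U n) \<in> C"
          using U_anti[of 0 n] start by auto
        moreover from calculation have "\<not> idx (target (U n)) < idx w"
          using N[OF that] by (auto simp: S_def)
        ultimately show ?thesis
          using target_le[OF w[of n]] inj less.prems by (auto simp: inj_on_def)
      qed
      then have "dist_in E (U (Suc n)) (r (Suc n)) w < dist_in E (U n) (r n) w" if "n \<ge> N" for n
        using nxt(5)[of n] that by simp
      then have "dist_in E (U (N + Suc n)) (r (N + Suc n)) w < dist_in E (U (N + n)) (r (N + n)) w"
        for n
        by simp
      moreover obtain k where "(dist_in E (U (N + Suc k)) (r (N + Suc k)) w,
          dist_in E (U (N + k)) (r (N + k)) w) \<notin> {(x, y). x < y}"
        by (rule wf_no_infinite_down_chainE[OF wf_less])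
      ultimately show False
        by simp
    qed
  qed
  have "(\<Union>i. T i) = C"
  proof
    show "(\<Union>i. T i) \<subseteq> C"
      using U_anti[of 0] start by (auto simp: T_def)
    show "C \<subseteq> (\<Union>i. T i)"
    proof
      fix w assume "w \<in> C"
      define n where "n = (LEAST n. w \<notin> U n)"
      have "w \<notin> U n"
        unfolding n_def using exhausted[OF \<open>w \<in> C\<close>] by (rule LeastI_ex)
      then obtain m where "n = Suc m"
        using \<open>w \<in> C\<close> start by (cases n) auto
      moreover have "w \<in> U m"
        using not_less_Least[of m "\<lambda>n. w \<notin> U n"] \<open>n = Suc m\<close> by (simp add: n_def)
      ultimately show "w \<in> (\<Union>i. T i)"
        using \<open>w \<notin> U n\<close> by (auto simp: T_def)
    qed
  qed
  moreover have "T i \<inter> T j = {}" if "i < j" for i j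
    using U_anti[of "Suc i" j] that by (auto simp: T_def)
  then have "disjoint_family T"
    unfolding disjoint_family_on_def by (metis Int_commute linorder_neqE_nat)
  moreover have "r i \<in> T i" for i
    using ok(2)[of i] nxt(1)[of i] by (auto simp: T_def)
  ultimately show thesis
    using that nxt(2-4) start(2) by blast
qed

section \<open>Hamiltonian paths in cubes of graphs with at most two ends\<close>

text \<open>After removal of \<open>F\<close>, the sets \<open>D\<close> and \<open>D'\<close> do not communicate, and \<open>D'\<close> holds an infinite component.
  It stays partly infinite after removal of a further finite set, so it accounts for one of the at
  most two ends and leaves at most one for \<open>D\<close>.\<close>

lemma one_end_beside_fat_component:
  assumes "sym E" and locfin: "\<And>x. finite (E `` {x})"
    and two: "at_most_two_ends E V" and "finite F" and "D \<subseteq> V" and "D \<inter> D' = {}"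
    and closed: "\<And>p q. p \<in> D \<Longrightarrow> (p, q) \<in> E \<Longrightarrow> p \<in> V - F \<Longrightarrow> q \<in> V - F \<Longrightarrow> q \<in> D"
    and closed': "\<And>p q. p \<in> D' \<Longrightarrow> (p, q) \<in> E \<Longrightarrow> p \<in> V - F \<Longrightarrow> q \<in> V - F \<Longrightarrow> q \<in> D'"
    and "v \<in> D'" and "infinite (component E (V - F) v)"
  shows "at_most_one_end E D"
  unfolding at_most_one_end_def
proof (intro allI impI)
  fix H x y
  assume "finite (H :: 'a set)"
    and x: "infinite (component E (D - H) x)" and y: "infinite (component E (D - H) y)"
  define W where "W = V - (F \<union> H)"
  have sub: "D - H - F \<subseteq> W" "V - F - H \<subseteq> W" "W \<inter> D \<subseteq> D - H" "W \<subseteq> V - F"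
    using assms(5) by (auto simp: W_def)
  have fat: "infinite (component E W u)" if "infinite (component E A u)" "A \<subseteq> W" for A u
    using that component_mono finite_subset by metis
  obtain x' where x': "x' \<in> component E (D - H) x" "infinite (component E (D - H - F) x')"
    using component_minus_finite[OF assms(1) locfin \<open>finite F\<close> x] by blast
  obtain y' where y': "y' \<in> component E (D - H) y" "infinite (component E (D - H - F) y')"
    using component_minus_finite[OF assms(1) locfin \<open>finite F\<close> y] by blast
  obtain v' where v': "v' \<in> component E (V - F) v" "infinite (component E (V - F - H) v')"
    using component_minus_finite[OF assms(1) locfin \<open>finite H\<close> assms(10)] by blast
  have "v' \<in> D'"
    using v'(1) component_closed[of v D' E "V - F"] assms(9) closed' by blast
  have "x' \<in> D" "y' \<in> D"
    using x'(2) y'(2) component_inside by fast+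
  have closedW: "q \<in> D" if "p \<in> D" "(p, q) \<in> E" "p \<in> W" "q \<in> W" for p q
    using closed that sub(4) by blast
  have "component E W x' \<subseteq> D" "component E W y' \<subseteq> D"
    using \<open>x' \<in> D\<close> \<open>y' \<in> D\<close> closedW component_closed by metis+
  moreover have "y' \<in> component E W x' \<or> v' \<in> component E W x' \<or> v' \<in> component E W y'"
    using two \<open>finite F\<close> \<open>finite H\<close> fat[OF x'(2) sub(1)] fat[OF y'(2) sub(1)] fat[OF v'(2) sub(2)]
    unfolding at_most_two_ends_def W_def by blast
  ultimately have "y' \<in> component E W x'"
    using \<open>v' \<in> D'\<close> assms(6) by blast
  then have "y' \<in> component E (W \<inter> D) x'"
    using \<open>x' \<in> D\<close> closedW by (rule component_confined)
  then have "y' \<in> component E (D - H) x'"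
    using component_mono[OF sub(3)] by blast
  then show "y \<in> component E (D - H) x"
    using x'(1) y'(1) component_sym[OF assms(1)] component_trans by metis
qed

text \<open>Add a walk from \<open>f\<close> to each of the finitely many vertices.\<close>

lemma finite_connected_superset:
  assumes "finite H" and "f \<in> V" and "H \<subseteq> component E V f"
  shows "\<exists>F. finite F \<and> H \<subseteq> F \<and> f \<in> F \<and> F \<subseteq> V \<and> F \<subseteq> component E F f"
  using assms(1,3)
proof (induction H)
  case empty
  then show ?case
    using assms(2) by (intro exI[of _ "{f}"]) auto
next
  case (insert z H)
  then obtain F where F: "finite F" "H \<subseteq> F" "f \<in> F" "F \<subseteq> V" "F \<subseteq> component E F f"
    by auto
  have "(f, z) \<in> (E \<inter> V \<times> V)\<^sup>*"
    using insert.prems by (simp add: component_def)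
  then have "\<exists>P. finite P \<and> f \<in> P \<and> z \<in> P \<and> P \<subseteq> V \<and> P \<subseteq> component E P f"
  proof (induction rule: rtrancl_induct)
    case base
    then show ?case
      using assms(2) by (intro exI[of _ "{f}"]) auto
  next
    case (step y z)
    then obtain P where P: "finite P" "f \<in> P" "y \<in> P" "P \<subseteq> V" "P \<subseteq> component E P f"
      by blast
    have "P \<subseteq> component E (insert z P) f"
      using P(5) component_mono[of P "insert z P" E f] by blast
    moreover from this have "z \<in> component E (insert z P) f"
      using P(3) step(2) component_step[of y E "insert z P" f z] by blast
    ultimately show ?case
      using P step(2) by (intro exI[of _ "insert z P"]) auto
  qed
  then obtain P where "finite P" "f \<in> P" "z \<in> P" "P \<subseteq> V" "P \<subseteq> component E P f"
    by blast
  with F show ?case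
    using component_mono[of F "F \<union> P" E f] component_mono[of P "F \<union> P" E f]
    by (intro exI[of _ "F \<union> P"]) auto
qed

lemma edge_near: "(x, y) \<in> E \<Longrightarrow> (x, y) \<in> (E\<^sup>=) ^^ 3"
  by (auto simp: numeral_3_eq_3)

lemma symp_near: "sym E \<Longrightarrow> symp (\<lambda>x y. (x, y) \<in> (E\<^sup>=) ^^ 3)"
  using sym_relpow[of "E\<^sup>=" 3] by (auto simp: sym_def symp_def)

text \<open>The whole vertex set is cut into a sequence of pieces with adjacent consecutive roots. The even
  pieces and the odd pieces are traversed separately, in opposite directions; this is why roots at
  distance two are allowed in \<open>ray_through_pieces\<close>.\<close>

lemma hamiltonian_cube_path_one_end:
  assumes "sym E" and locfin: "\<And>x. finite (E `` {x})" and "infinite V"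
    and conn: "\<And>x y. x \<in> V \<Longrightarrow> y \<in> V \<Longrightarrow> y \<in> component E V x"
    and one: "at_most_one_end E V"
  obtains p :: "int \<Rightarrow> 'a" where "bij_betw p UNIV V" and "\<And>i. (p i, p (i + 1)) \<in> (E\<^sup>=) ^^ 3"
proof -
  obtain a where "a \<in> V"
    using \<open>infinite V\<close> by fastforce
  obtain T r where T: "\<And>i. finite (T i)" "\<And>i. r i \<in> T i"
    "\<And>i. T i \<subseteq> component E (T i) (r i)" "\<And>i. (r i, r (Suc i)) \<in> E"
    "disjoint_family T" "(\<Union>i. T i) = V"
    using one_ended_pieces[OF assms(1) locfin \<open>infinite V\<close> \<open>a \<in> V\<close> _ one] conn[OF \<open>a \<in> V\<close>]
    by (metis subsetI)
  have skip: "(r i, r (Suc (Suc i))) \<in> (E\<^sup>=) ^^ 2" for i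
    using T(4)[of i] T(4)[of "Suc i"] by (auto simp: numeral_2_eq_2)
  have disj: "disjoint_family (\<lambda>i. T (g i))" if "inj g" for g
    using T(5) that by (auto simp: disjoint_family_on_def inj_eq)
  obtain q where q: "bij_betw q UNIV (\<Union>i. T (2 * i))" "q 0 = r (2 * 0)"
    "\<And>n. (q n, q (Suc n)) \<in> (E\<^sup>=) ^^ 3"
    by (rule ray_through_pieces[OF assms(1), where T = "\<lambda>i. T (2 * i)" and r = "\<lambda>i. r (2 * i)"])
      (use T skip disj[of "\<lambda>i. 2 * i"] in \<open>auto simp: inj_on_def\<close>)
  obtain q' where q': "bij_betw q' UNIV (\<Union>i. T (Suc (2 * i)))" "q' 0 = r (Suc (2 * 0))"
    "\<And>n. (q' n, q' (Suc n)) \<in> (E\<^sup>=) ^^ 3"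
    by (rule ray_through_pieces[OF assms(1), where T = "\<lambda>i. T (Suc (2 * i))"
          and r = "\<lambda>i. r (Suc (2 * i))"])
      (use T skip disj[of "\<lambda>i. Suc (2 * i)"] in \<open>auto simp: inj_on_def\<close>)
  have "T (2 * i) \<inter> T (Suc (2 * j)) = {}" for i j
  proof -
    have "2 * i \<noteq> Suc (2 * j)"
      by (rule Suc_double_not_eq_double[symmetric])
    then show ?thesis
      using T(5) by (auto simp: disjoint_family_on_def)
  qed
  then have "(\<Union>i. T (2 * i)) \<inter> (\<Union>i. T (Suc (2 * i))) = {}"
    by blast
  moreover have "(q' 0, q 0) \<in> (E\<^sup>=) ^^ 3"
    using T(4)[of 0] assms(1) q(2) q'(2) by (auto intro!: edge_near dest: symD)
  moreover have "(\<Union>i. T (2 * i)) \<union> (\<Union>i. T (Suc (2 * i))) = V"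
  proof -
    have "T i \<subseteq> (\<Union>i. T (2 * i)) \<union> (\<Union>i. T (Suc (2 * i)))" for i
      by (cases "even i") (auto elim!: evenE oddE)
    then show ?thesis
      using T(6) by blast
  qed
  ultimately show thesis
    using glue_rays[OF q(1) q'(1) _ symp_near[OF assms(1)] _ q(3) q'(3)] that by metis
qed

text \<open>Some finite set separates two infinite components. After it is enlarged to a connected set \<open>F\<close>, one
  infinite component \<open>B\<close> of the rest and the complement \<open>A\<close> of \<open>B\<close> are both connected and one-ended, and
  they yield the two halves of the path, starting at the two ends of an edge between them.\<close>

lemma hamiltonian_cube_path_two_ends:
  assumes "sym E" and locfin: "\<And>x. finite (E `` {x})" and "infinite V"
    and conn: "\<And>x y. x \<in> V \<Longrightarrow> y \<in> V \<Longrightarrow> y \<in> component E V x"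
    and two: "at_most_two_ends E V" and two_ends: "\<not> at_most_one_end E V"
  obtains p :: "int \<Rightarrow> 'a" where "bij_betw p UNIV V" and "\<And>i. (p i, p (i + 1)) \<in> (E\<^sup>=) ^^ 3"
proof -
  have edge2: "(x, y) \<in> (E\<^sup>=) ^^ 2" if "(x, y) \<in> E" for x y
    using that by (auto simp: numeral_2_eq_2)
  obtain H x y where "finite H" and x: "infinite (component E (V - H) x)"
    and y: "infinite (component E (V - H) y)" and xy: "y \<notin> component E (V - H) x"
    using two_ends by (auto simp: at_most_one_end_def)
  obtain f where "f \<in> V"
    using \<open>infinite V\<close> by fastforce
  obtain F where F: "finite F" "H \<inter> V \<subseteq> F" "f \<in> F" "F \<subseteq> V" "F \<subseteq> component E F f"
    using finite_connected_superset[of "H \<inter> V" f V E] \<open>finite H\<close> \<open>f \<in> V\<close> conn by auto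
  have V_minus: "V - H - F = V - F" "V - F \<subseteq> V - H"
    using F(2) by auto
  obtain x' where x': "x' \<in> component E (V - H) x" "infinite (component E (V - F) x')"
    using component_minus_finite[OF assms(1) locfin F(1) x] unfolding V_minus by blast
  obtain y' where y': "y' \<in> component E (V - H) y" "infinite (component E (V - F) y')"
    using component_minus_finite[OF assms(1) locfin F(1) y] unfolding V_minus by blast
  \<comment> \<open>The infinite component of \<open>x'\<close> ends up in \<open>A\<close>; that of \<open>y'\<close> is \<open>B\<close>.\<close>
  define B where "B = component E (V - F) y'"
  define A where "A = V - B"
  have "y' \<in> V - F" "x' \<in> V - F"
    using x'(2) y'(2) by (auto dest: component_inside)
  then have B_sub: "B \<subseteq> V - F"
    unfolding B_def by (intro component_subset)
  have "x' \<notin> B"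
  proof
    assume "x' \<in> B"
    then have "x' \<in> component E (V - H) y'"
      unfolding B_def using component_mono[OF V_minus(2)] by blast
    then show False
      using x'(1) y'(1) xy component_sym[OF assms(1)] component_trans by metis
  qed
  have B_closed: "q \<in> B" if "p \<in> B" "(p, q) \<in> E" "p \<in> V - F" "q \<in> V - F" for p q
    using that unfolding B_def by (rule component_step)
  have A_closed: "q \<in> A" if "p \<in> A" "(p, q) \<in> E" "p \<in> V - F" "q \<in> V - F" for p q
    using B_closed[of q p] that assms(1) by (auto simp: A_def dest: symD)
  have "F \<subseteq> A"
    using F(4) B_sub by (auto simp: A_def)
  have "at_most_one_end E B"
  proof (rule one_end_beside_fat_component[OF assms(1) locfin two F(1)])
    show "B \<subseteq> V" "B \<inter> A = {}" "x' \<in> A"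
      using B_sub \<open>x' \<in> V - F\<close> \<open>x' \<notin> B\<close> by (auto simp: A_def)
  qed (fact B_closed A_closed x'(2))+
  have "at_most_one_end E A"
  proof (rule one_end_beside_fat_component[OF assms(1) locfin two F(1)])
    show "A \<subseteq> V" "A \<inter> B = {}" "y' \<in> B"
      by (auto simp: A_def B_def)
  qed (fact B_closed A_closed y'(2))+
  have "infinite B"
    using y' by (simp add: B_def)
  have "component E (V - F) x' \<subseteq> A"
    using \<open>x' \<in> V - F\<close> \<open>x' \<notin> B\<close> A_closed by (intro component_closed) (auto simp: A_def)
  then have "infinite A"
    using x'(2) finite_subset by blast
  have "V \<subseteq> component E V f"
    using conn \<open>f \<in> V\<close> by blast
  moreover have "y' \<in> V - A"
    using \<open>y' \<in> V - F\<close> by (simp add: A_def B_def)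
  moreover have "f \<in> A"
    using F(3) \<open>F \<subseteq> A\<close> by blast
  ultimately obtain a b where ab: "a \<in> A" "b \<in> B" "(a, b) \<in> E"
    using component_closed[of f A E V] unfolding A_def by blast
  \<comment> \<open>\<open>A\<close> is connected: a walk that returns to \<open>A\<close> from \<open>B\<close> returns through the connected set \<open>F\<close>.\<close>
  have "component E V f \<subseteq> B \<union> component E A f"
  proof (rule component_closed)
    fix p q assume pq: "p \<in> B \<union> component E A f" "(p, q) \<in> E" "p \<in> V" "q \<in> V"
    show "q \<in> B \<union> component E A f"
    proof (cases "q \<in> B")
      case False
      then have "q \<in> A"
        using pq by (simp add: A_def)
      show ?thesis
      proof (cases "p \<in> B")
        case True
        then have "q \<in> F"
          using False B_closed pq B_sub by blast
        then show ?thesis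
          using F(5) component_mono[OF \<open>F \<subseteq> A\<close>] by blast
      next
        case False
        then have "q \<in> component E A f"
          using pq \<open>q \<in> A\<close> by (intro component_step[of p E A f q]) (auto simp: A_def)
        then show ?thesis by blast
      qed
    qed simp
  qed simp
  with \<open>V \<subseteq> component E V f\<close> have "V \<subseteq> B \<union> component E A f"
    by (rule subset_trans)
  moreover have "A \<subseteq> V" "A \<inter> B = {}"
    by (auto simp: A_def)
  ultimately have "A \<subseteq> component E A f"
    by blast
  then have "A \<subseteq> component E A a"
    using ab(1) component_sym[OF assms(1)] component_trans by (metis subset_iff)
  have "B \<subseteq> component E B b"
    using component_connected_from[OF assms(1) \<open>y' \<in> V - F\<close>, of b] ab(2) by (simp add: B_def)
  obtain T r where
    T: "\<And>i. finite (T i)" "\<And>i. r i \<in> T i" "\<And>i. T i \<subseteq> component E (T i) (r i)"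
      "\<And>i. (r i, r (Suc i)) \<in> E" "disjoint_family T" "(\<Union>i. T i) = A" "r 0 = a"
    using one_ended_pieces[OF assms(1) locfin \<open>infinite A\<close> ab(1) \<open>A \<subseteq> component E A a\<close>
        \<open>at_most_one_end E A\<close>] by metis
  obtain T' r' where
    T': "\<And>i. finite (T' i)" "\<And>i. r' i \<in> T' i" "\<And>i. T' i \<subseteq> component E (T' i) (r' i)"
      "\<And>i. (r' i, r' (Suc i)) \<in> E" "disjoint_family T'" "(\<Union>i. T' i) = B" "r' 0 = b"
    using one_ended_pieces[OF assms(1) locfin \<open>infinite B\<close> ab(2) \<open>B \<subseteq> component E B b\<close>
        \<open>at_most_one_end E B\<close>] by metis
  obtain q where q: "bij_betw q UNIV (\<Union>i. T i)" "q 0 = r 0"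
    "\<And>n. (q n, q (Suc n)) \<in> (E\<^sup>=) ^^ 3"
    by (rule ray_through_pieces[OF assms(1) T(1,2,3,5) edge2[OF T(4)]]) (rule that)
  obtain q' where q': "bij_betw q' UNIV (\<Union>i. T' i)" "q' 0 = r' 0"
    "\<And>n. (q' n, q' (Suc n)) \<in> (E\<^sup>=) ^^ 3"
    by (rule ray_through_pieces[OF assms(1) T'(1,2,3,5) edge2[OF T'(4)]]) (rule that)
  have "(q' 0, q 0) \<in> (E\<^sup>=) ^^ 3"
    using ab(3) assms(1) q(2) q'(2) T(7) T'(7) by (auto intro!: edge_near dest: symD)
  moreover have "A \<inter> B = {}" "A \<union> B = V"
    using B_sub by (auto simp: A_def)
  ultimately have "(q' 0, q 0) \<in> (E\<^sup>=) ^^ 3" "(\<Union>i. T i) \<inter> (\<Union>i. T' i) = {}"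
    "(\<Union>i. T i) \<union> (\<Union>i. T' i) = V"
    using T(6) T'(6) by simp_all
  with glue_rays[OF q(1) q'(1) _ symp_near[OF assms(1)] _ q(3) q'(3)] that show thesis
    by metis
qed

theorem hamiltonian_cube_path:
  assumes "sym E" and locfin: "\<And>x. finite (E `` {x})" and "infinite V"
    and conn: "\<And>x y. x \<in> V \<Longrightarrow> y \<in> V \<Longrightarrow> y \<in> component E V x"
    and "at_most_two_ends E V"
  obtains p :: "int \<Rightarrow> 'a" where "bij_betw p UNIV V" and "\<And>i. (p i, p (i + 1)) \<in> (E\<^sup>=) ^^ 3"
proof (cases "at_most_one_end E V")
  case True
  show thesis
    by (rule hamiltonian_cube_path_one_end[OF assms(1-4) True]) (assumption | rule that)+
next
  case False
  show thesis
    by (rule hamiltonian_cube_path_two_ends[OF assms False]) (assumption | rule that)+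
qed

section \<open>Hamiltonian paths in Cayley graphs\<close>

lemma (in group) cayley_hamiltonian_path:
  assumes "finite S" and "S \<subseteq> carrier G" and "generate G S = carrier G"
    and "infinite (carrier G)" and "at_most_two_ends (cayley_arcs G S) (carrier G)"
  obtains p where "bi_infinite_hamiltonian_path
    (cayley_graph G {g \<in> carrier G. word_dist G S g \<one> \<le> 3}) p"
proof -
  obtain p :: "int \<Rightarrow> 'a" where p: "bij_betw p UNIV (carrier G)"
    "\<And>i. (p i, p (i + 1)) \<in> ((cayley_arcs G S)\<^sup>=) ^^ 3"
    by (rule hamiltonian_cube_path[OF sym_cayley_arcs[OF assms(2)]
        finite_cayley_neighbours[OF assms(1)] assms(4) cayley_connected[OF assms(2,3)] assms(5)])
      (assumption | rule that)+
  have "p i \<in> carrier G" for i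
    using bij_betwE[OF p(1)] by simp
  then have "(p i, p (i + 1)) \<in> cayley_arcs G {g \<in> carrier G. word_dist G S g \<one> \<le> 3}" for i
    by (rule cayley_walk_arc[OF assms(2) _ p(2)])
  with p(1) show thesis
    by (intro that) (auto simp: bi_infinite_hamiltonian_path_def cayley_arcs_def)
qed

theorem corollary1p4:
  fixes G :: "('a, 'm) monoid_scheme" and S :: "'a set"
  assumes "group G"
    and "finitely_generated G"
    and "group_ends G = 1 \<or> group_ends G = 2"
    and "finite_generating_set G S"
  shows "\<exists>p. bi_infinite_hamiltonian_path
    (cayley_graph G {g \<in> carrier G. word_dist G S g \<one>\<^bsub>G\<^esub> \<le> 3}) p"
proof -
  have gen: "finite S" "S \<subseteq> carrier G" "generate G S = carrier G"
    using assms(4) by (auto simp: finite_generating_set_def)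
  have "group_ends G \<noteq> 0" "group_ends G \<le> 2"
    using assms(3) by (auto simp: one_enat_def zero_enat_def numeral_eq_enat)
  then have "infinite (carrier G)" "at_most_two_ends (cayley_arcs G S) (carrier G)"
    using infinite_verts_if_graph_ends[of "cayley_graph G (SOME T. finite_generating_set G T)"]
      group.at_most_two_ends_cayley[OF assms(1) _ assms(4)]
    by (simp_all add: group_ends_def)
  then show ?thesis
    by (rule group.cayley_hamiltonian_path[OF assms(1) gen]) (rule exI)
qed

end
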